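(* Let $h\in\mathbb{Z}$, $r\in\mathbb{N}$, $n\in\mathbb{Z}_+$ and $x\in\mathbb{Z}_p$. Define the numbers $G_{k,w,q}^{(h,r)}(x)$ ($k\in\mathbb{Z}_+$) by $$2^r t^r\sum_{m=0}^{\infty}\binom{m+r-1}{m}_{q^{-1}}(-1)^m q^{hm}w^m e^{t[m+x]_q}=\sum_{k=0}^{\infty}G_{k,w,q}^{(h,r)}(x)\frac{t^k}{k!},$$ and let $$E_{n,w,q}^{(h,r)}(x)=\int_{\mathbb{Z}_p^r} w^{x_1+\cdots+x_r}[x+x_1+\cdots+x_r]_q^n\,q^{\sum_{i=1}^{r}(h-i+1)x_i}\,d\mu_{-1}(x_1)\cdots d\mu_{-1}(x_r).$$ Then $$\frac{G_{n+r,w,q}^{(h,r)}(x)}{r!\binom{n+r}{r}}=\int_{\mathbb{Z}_p^r} q^{\sum_{i=1}^{r}(h-i+1)x_i}w^{x_1+\cdots+x_r}[x+x_1+\cdots+x_r]_q^n\,d\mu_{-1}(x_1)\cdots d\mu_{-1}(x_r)=E_{n,w,q}^{(h,r)}(x),$$ and $G_{0,w,q}^{(h,r)}(x)=G_{1,w,q}^{(h,r)}(x)=\cdots=G_{r-1,w,q}^{(h,r)}(x)=0$.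
   Context: Let $p$ be a fixed odd prime, $\mathbb{Z}_p$ the ring of $p$-adic integers, $\mathbb{C}_p$ the completion of the algebraic closure of $\mathbb{Q}_p$, and $\mathbb{Z}_+=\mathbb{N}\cup\{0\}$. Let $q,w\in\mathbb{C}_p$ with $|1-q|_p<1$ and $|1-w|_p<1$. For $x\in\mathbb{Z}_p$ put $[x]_q=\frac{1-q^x}{1-q}$; $[k]_q!=[k]_q\cdots[1]_q$; $\binom{n}{k}_q=\frac{[n]_q[n-1]_q\cdots[n-k+1]_q}{[k]_q!}$. For a uniformly differentiable function $f:\mathbb{Z}_p\to\mathbb{C}_p$, the fermionic $p$-adic integral is $\int_{\mathbb{Z}_p}f(x)\,d\mu_{-1}(x)=\lim_{N\to\infty}\sum_{x=0}^{p^N-1}f(x)(-1)^x$, and $\int_{\mathbb{Z}_p^r}$ denotes the $r$-fold iterated fermionic integral.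
   Formalization: The series defining G diverges p-adically, so it is summed coefficientwise in t by rational continuation of Σ a_m z^m to z=1; at q=1, [x]_q is read as x, and where [k]_q! vanishes the q-binomial is the Gaussian polynomial evaluated at its base. *)

theory Defs
  imports
    "HOL-Analysis.Analysis"
    "HOL-Computational_Algebra.Computational_Algebra"
begin

abbreviation pnorm :: "'a::{field_char_0,complete_space} \<Rightarrow> real"
  where "pnorm x \<equiv> dist x 0"

text \<open>Inside a complete valued field of characteristic 0 extending the \<open>p\<close>-adic absolute value,
  the closure of the rationals is the completion of the rationals, i.e. the field of
  \<open>p\<close>-adic numbers.\<close>

definition Qp :: "'a::{field_char_0,complete_space} set"
  where "Qp = closure \<rat>"

definition Zp :: "'a::{field_char_0,complete_space} set"
  where "Zp = {x \<in> Qp. pnorm x \<le> 1}"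

definition Qp_bar :: "'a::{field_char_0,complete_space} set"
  where "Qp_bar = {x. \<exists>P. P \<noteq> 0 \<and> set (coeffs P) \<subseteq> Qp \<and> poly P x = 0}"

text \<open>The type \<open>'a\<close> is the completion of an algebraic closure of the \<open>p\<close>-adic numbers;
  these conditions determine it up to isometric isomorphism. Completeness is part of the sort.\<close>

locale padic_complex_field =
  fixes p :: nat and ty :: "'a::{field_char_0,complete_space} itself"
  assumes prime_p: "prime p"
    and dist_diff: "\<And>x y::'a. dist x y = pnorm (x - y)"
    and pnorm_mult: "\<And>x y::'a. pnorm (x * y) = pnorm x * pnorm y"
    and pnorm_ultra: "\<And>x y::'a. pnorm (x + y) \<le> max (pnorm x) (pnorm y)"
    and pnorm_p: "pnorm (of_nat p :: 'a) = 1 / real p"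
    and Qp_bar_closed: "\<And>P::'a poly. set (coeffs P) \<subseteq> Qp_bar \<Longrightarrow> degree P > 0 \<Longrightarrow>
          \<exists>x\<in>Qp_bar. poly P x = 0"
    and Qp_bar_dense: "closure (Qp_bar :: 'a set) = UNIV"

text \<open>The power \<open>a\<^sup>x\<close> for \<open>pnorm (1 - a) < 1\<close> and a \<open>p\<close>-adic integer \<open>x\<close>,
  given by the binomial series.\<close>

definition zpow :: "'a::{field_char_0,complete_space} \<Rightarrow> 'a \<Rightarrow> 'a"
  where "zpow a x = (\<Sum>n. (x gchoose n) * (a - 1) ^ n)"

lemma zpow_of_nat: "zpow a (of_nat m) = a ^ m"
proof -
  have "zpow a (of_nat m) = (\<Sum>n\<le>m. (of_nat m gchoose n) * (a - 1) ^ n)"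
    unfolding zpow_def
    by (rule suminf_finite) (auto simp flip: binomial_gbinomial simp: binomial_eq_0)
  also have "\<dots> = ((a - 1) + 1) ^ m"
    by (subst binomial_ring) (simp flip: binomial_gbinomial)
  finally show ?thesis by simp
qed

text \<open>At \<open>q = 1\<close>, where the quotient is not defined, the usual limit value \<open>x\<close> is taken.\<close>

definition qnum :: "'a::{field_char_0,complete_space} \<Rightarrow> 'a \<Rightarrow> 'a"
  where "qnum q x = (if q = 1 then x else (1 - zpow q x) / (1 - q))"

text \<open>The Gaussian binomial coefficient. The hypothesis \<open>pnorm (1 - q) < 1\<close> allows \<open>q\<close> to be
  a root of unity of \<open>p\<close>-power order, for which the \<open>q\<close>-factorial in the denominator may vanish.
  Therefore the quotient is formed (exactly) in the polynomial ring and then evaluated at \<open>q\<close>;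
  lemma \<open>qbinom_eq_quotient\<close> shows that it is the usual quotient of \<open>q\<close>-numbers
  whenever the denominator is nonzero.\<close>

definition qnum_poly :: "nat \<Rightarrow> 'a::field_char_0 poly"
  where "qnum_poly n = (\<Sum>i<n. monom 1 i)"

definition qbinom :: "nat \<Rightarrow> nat \<Rightarrow> 'a::field_char_0 \<Rightarrow> 'a"
  where "qbinom n k q =
    poly ((\<Prod>i<k. qnum_poly (n - i)) div (\<Prod>i=1..k. qnum_poly i)) q"

lemma qnum_of_nat: "qnum q (of_nat n) = poly (qnum_poly n) q"
  by (auto simp: qnum_def qnum_poly_def zpow_of_nat poly_sum poly_monom sum_gp_strict)

lemma qnum_poly_add: "qnum_poly (a + b) = qnum_poly a + monom 1 a * qnum_poly b"
  by (induction b) (simp_all add: qnum_poly_def mult_monom algebra_simps)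

lemma qfact_poly_dvd:
  "(\<Prod>i=1..k. qnum_poly i) dvd (\<Prod>i<k. qnum_poly (n - i) :: 'a::field_char_0 poly)"
proof (induction n arbitrary: k)
  case 0
  show ?case by (cases k) (auto simp: qnum_poly_def lessThan_Suc)
next
  case (Suc n)
  show ?case
  proof (cases k)
    case 0
    then show ?thesis by simp
  next
    case k: (Suc j)
    let ?P = "\<lambda>n k. \<Prod>i<k. qnum_poly (n - i) :: 'a poly"
    let ?F = "\<lambda>k. \<Prod>i=1..k. qnum_poly i :: 'a poly"
    have P: "?P (Suc n) (Suc j) = qnum_poly (Suc n) * ?P n j"
      by (simp add: prod.lessThan_Suc_shift del: prod.lessThan_Suc)
    have F: "?F (Suc j) = qnum_poly (Suc j) * ?F j" by (simp add: mult.commute)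
    show ?thesis
    proof (cases "j \<le> n")
      case True
      have split: "qnum_poly (Suc n) =
          qnum_poly (Suc j) + monom 1 (Suc j) * (qnum_poly (n - j) :: 'a poly)"
        using True by (simp flip: qnum_poly_add)
      have "?P (Suc n) (Suc j) =
          qnum_poly (Suc j) * ?P n j + monom 1 (Suc j) * ?P n (Suc j)"
        unfolding P split by (simp add: algebra_simps)
      moreover have "?F (Suc j) dvd qnum_poly (Suc j) * ?P n j"
        unfolding F using Suc.IH by (intro mult_dvd_mono) auto
      moreover have "?F (Suc j) dvd monom 1 (Suc j) * ?P n (Suc j)"
        by (intro dvd_mult Suc.IH)
      ultimately show ?thesis unfolding k by (metis dvd_add)
    next
      case False
      then have "?P (Suc n) (Suc j) = 0"
        by (intro prod_zero) (auto simp: qnum_poly_def intro!: bexI[of _ "Suc n"])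
      then show ?thesis unfolding k by (metis dvd_0_right)
    qed
  qed
qed

lemma qbinom_eq_quotient:
  fixes q :: "'a::{field_char_0,complete_space}"
  assumes "(\<Prod>i=1..k. qnum q (of_nat i)) \<noteq> 0"
  shows "qbinom n k q =
    (\<Prod>i<k. qnum q (of_nat (n - i))) / (\<Prod>i=1..k. qnum q (of_nat i))"
proof -
  let ?N = "\<Prod>i<k. qnum_poly (n - i) :: 'a poly"
  let ?D = "\<Prod>i=1..k. qnum_poly i :: 'a poly"
  have "poly (?N div ?D) q * poly ?D q = poly ?N q"
    unfolding poly_mult[symmetric] dvd_div_mult_self[OF qfact_poly_dvd] ..
  then show ?thesis
    using assms by (simp add: qbinom_def qnum_of_nat poly_prod field_simps)
qed

text \<open>The series in the generating function below never converges \<open>p\<close>-adically: its terms do not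
  tend to 0. It is summed, as is implicit in such generating functions, by continuing
  the power series \<open>\<Sum>\<^sub>m a\<^sub>m z\<^sup>m\<close> as a rational function to \<open>z = 1\<close>, e.g.
  \<open>\<Sum>\<^sub>m (-1)\<^sup>m c\<^sup>m = 1 / (1 + c)\<close>.\<close>

definition reg_sums :: "(nat \<Rightarrow> 'a::field) \<Rightarrow> 'a \<Rightarrow> bool"
  where "reg_sums a s \<longleftrightarrow> (\<exists>P Q. fps_of_poly Q * Abs_fps a = fps_of_poly P \<and>
    poly Q 1 \<noteq> 0 \<and> s = poly P 1 / poly Q 1)"

definition reg_sum :: "(nat \<Rightarrow> 'a::field) \<Rightarrow> 'a"
  where "reg_sum a = (THE s. reg_sums a s)"

lemma reg_sums_unique:
  assumes "reg_sums a s" "reg_sums a t"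
  shows "s = t"
proof -
  obtain P Q where 1: "fps_of_poly Q * Abs_fps a = fps_of_poly P" "poly Q 1 \<noteq> 0"
    "s = poly P 1 / poly Q 1" using assms(1) unfolding reg_sums_def by blast
  obtain P' Q' where 2: "fps_of_poly Q' * Abs_fps a = fps_of_poly P'" "poly Q' 1 \<noteq> 0"
    "t = poly P' 1 / poly Q' 1" using assms(2) unfolding reg_sums_def by blast
  have "fps_of_poly (P * Q') = fps_of_poly (P' * Q)"
    unfolding fps_of_poly_mult 1(1)[symmetric] 2(1)[symmetric] by (simp add: mult_ac)
  then have "P * Q' = P' * Q" by simp
  then have "poly P 1 * poly Q' 1 = poly P' 1 * poly Q 1" by (metis poly_mult)
  then show ?thesis unfolding 1(3) 2(3) using 1(2) 2(2) by (simp add: frac_eq_eq)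
qed

lemma reg_sum_eq: "reg_sums a s \<Longrightarrow> reg_sum a = s"
  unfolding reg_sum_def using reg_sums_unique by blast

lemma reg_sums_geometric:
  assumes "c \<noteq> 1"
  shows "reg_sums (\<lambda>m. c ^ m) (1 / (1 - c))"
  unfolding reg_sums_def
proof (intro exI conjI)
  show "fps_of_poly [:1, - c:] * Abs_fps (\<lambda>m. c ^ m) = fps_of_poly 1"
  proof (rule fps_ext)
    fix n show "fps_nth (fps_of_poly [:1, - c:] * Abs_fps (\<lambda>m. c ^ m)) n = fps_nth (fps_of_poly 1) n"
      by (cases n) (simp_all add: fps_of_poly_pCons algebra_simps)
  qed
qed (use assms in auto)

definition fps_reg_sum :: "(nat \<Rightarrow> 'a::field fps) \<Rightarrow> 'a fps"
  where "fps_reg_sum F = Abs_fps (\<lambda>k. reg_sum (\<lambda>m. fps_nth (F m) k))"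

definition genocchi_gf ::
    "int \<Rightarrow> nat \<Rightarrow> 'a::{field_char_0,complete_space} \<Rightarrow> 'a \<Rightarrow> 'a \<Rightarrow> 'a fps"
  where "genocchi_gf h r w q x =
    fps_const (2 ^ r) * fps_X ^ r *
      fps_reg_sum (\<lambda>m. fps_const
        (qbinom (m + r - 1) m (inverse q) * (-1) ^ m * power_int q (h * int m) * w ^ m) *
        fps_exp (qnum q (of_nat m + x)))"

definition genocchi ::
    "int \<Rightarrow> nat \<Rightarrow> 'a::{field_char_0,complete_space} \<Rightarrow> 'a \<Rightarrow> nat \<Rightarrow> 'a \<Rightarrow> 'a"
  where "genocchi h r w q k x = fact k * fps_nth (genocchi_gf h r w q x) k"

lemma genocchi_gf_expansion:
  "genocchi_gf h r w q x = Abs_fps (\<lambda>k. genocchi h r w q k x / fact k)"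
  by (simp add: genocchi_def fps_eq_iff)

definition fermionic_integral :: "nat \<Rightarrow> ('a::{field_char_0,complete_space} \<Rightarrow> 'a) \<Rightarrow> 'a"
  where "fermionic_integral p f = lim (\<lambda>N. \<Sum>x<p ^ N. f (of_nat x) * (-1) ^ x)"

text \<open>The \<open>r\<close>-fold iterated integral in the variables \<open>X 1, \<dots>, X r\<close>, the integration over
  \<open>X 1\<close> being innermost; the integrand must not depend on the other values of \<open>X\<close>.\<close>

primrec fermionic_integral_iter ::
    "nat \<Rightarrow> nat \<Rightarrow> ((nat \<Rightarrow> 'a::{field_char_0,complete_space}) \<Rightarrow> 'a) \<Rightarrow> 'a"
  where
    "fermionic_integral_iter p 0 f = f (\<lambda>_. 0)"
  | "fermionic_integral_iter p (Suc r) f =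
      fermionic_integral p (\<lambda>y. fermionic_integral_iter p r (\<lambda>X. f (X(Suc r := y))))"

definition euler ::
    "nat \<Rightarrow> int \<Rightarrow> nat \<Rightarrow> 'a::{field_char_0,complete_space} \<Rightarrow> 'a \<Rightarrow> nat \<Rightarrow> 'a \<Rightarrow> 'a"
  where "euler p h r w q n x =
    fermionic_integral_iter p r (\<lambda>X.
      zpow w (\<Sum>i=1..r. X i) * qnum q (x + (\<Sum>i=1..r. X i)) ^ n *
      zpow q (\<Sum>i=1..r. of_int (h - int i + 1) * X i))"

end

theory Submission
  imports Defs
begin

text \<open>
  Since \<open>[y + 1] = 1 + q [y]\<close>, the shift of \<open>y\<close> by 1 acts on the functions \<open>y \<mapsto> P [y]\<close>
  as the operator \<open>E P = P (1 + q X)\<close> on polynomials. Put \<open>c\<^sub>i = q\<^bsup>h - i + 1\<^esup> w\<close>. The operators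
  \<open>1 + c\<^sub>i E\<close> commute, and each is triangular with respect to the degree with diagonal entries
  \<open>1 + c\<^sub>i q\<^sup>n\<close>, which do not vanish because \<open>c\<^sub>i q\<^sup>n\<close> is close to 1 and \<open>p\<close> is odd. Hence
  \<open>X\<^sup>n = (1 + c\<^sub>1 E) \<cdots> (1 + c\<^sub>r E) G\<close> for some polynomial \<open>G\<close>. Integrating
  \<open>c\<^sup>z ((1 + c E) G) [y + z]\<close> over \<open>z\<close> telescopes to \<open>2 G [y]\<close>, so the \<open>r\<close>-fold integral
  is \<open>2\<^sup>r G [x]\<close>. On the other side, the \<open>q\<close>-Pascal rule shows that passing from \<open>r\<close> to \<open>r - 1\<close>
  in the series absorbs the factor \<open>1 + c\<^sub>r E\<close>, so the regularized sum is \<open>G [x]\<close>.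
  This argument includes \<open>q = 1\<close> and roots of unity.
\<close>

subsection \<open>Ultrametric analysis\<close>

context padic_complex_field
begin

lemma pnorm_one: "pnorm (1::'a) = 1"
  using pnorm_mult[of 1 1] by simp

lemma pnorm_minus: "pnorm (- x::'a) = pnorm x"
  using dist_diff[of 0 x] by (simp add: dist_commute)

lemma pnorm_diff_commute: "pnorm (x - y::'a) = pnorm (y - x)"
  using pnorm_minus[of "x - y"] by simp

lemma pnorm_ultra_diff: "pnorm (x - y::'a) \<le> max (pnorm x) (pnorm y)"
  using pnorm_ultra[of x "- y"] by (simp add: pnorm_minus)

lemma pnorm_power: "pnorm (x ^ n::'a) = pnorm x ^ n"
  by (induction n) (simp_all add: pnorm_one pnorm_mult)

lemma pnorm_of_nat_le: "pnorm (of_nat n::'a) \<le> 1"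
proof (induction n)
  case (Suc n)
  then show ?case using pnorm_ultra[of 1 "of_nat n"] by (simp add: pnorm_one)
qed simp

lemma pnorm_of_int_le: "pnorm (of_int k::'a) \<le> 1"
  using pnorm_of_nat_le[of "nat \<bar>k\<bar>"] by (cases "k \<ge> 0") (auto simp: pnorm_minus)

lemma pnorm_sum_le:
  assumes "\<And>i. i \<in> A \<Longrightarrow> pnorm (f i::'a) \<le> B" "0 \<le> B"
  shows "pnorm (sum f A) \<le> B"
  using assms
proof (induction A rule: infinite_finite_induct)
  case (insert i A)
  then show ?case using pnorm_ultra[of "f i" "sum f A"] by (force simp: max_def split: if_splits)
qed auto

section \<open>Limits in the valued field\<close>

lemma tendsto_iff_pnorm: "(f \<longlongrightarrow> (l::'a)) F \<longleftrightarrow> ((\<lambda>n. pnorm (f n - l)) \<longlongrightarrow> 0) F"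
  using tendsto_dist_iff[of f l F] by (simp add: dist_diff[of _ l])

lemma tendsto_pnorm_bound:
  assumes "\<And>n. pnorm (f n - (l::'a)) \<le> g n" "(g \<longlongrightarrow> 0) F"
  shows "(f \<longlongrightarrow> l) F"
  unfolding tendsto_iff_pnorm
  by (rule tendsto_sandwich[OF _ _ tendsto_const assms(2)]) (use assms(1) in auto)

lemma pnorm_add_le: "pnorm (x + y::'a) \<le> pnorm x + pnorm y"
  using pnorm_ultra[of x y] zero_le_dist[of x 0] zero_le_dist[of y 0] by linarith

text \<open>The sort of \<open>'a\<close> relates neither addition nor multiplication to the metric,
  so their continuity is derived from the locale axioms, here and in the next lemmas.\<close>

lemma padic_tendsto_add:
  assumes "(f \<longlongrightarrow> (a::'a)) F" "(g \<longlongrightarrow> b) F"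
  shows "((\<lambda>n. f n + g n) \<longlongrightarrow> a + b) F"
proof -
  have "((\<lambda>n. pnorm (f n - a) + pnorm (g n - b)) \<longlongrightarrow> 0) F"
    using tendsto_add[OF assms[unfolded tendsto_iff_pnorm]] by simp
  moreover have "pnorm (f n + g n - (a + b)) \<le> pnorm (f n - a) + pnorm (g n - b)" for n
    using pnorm_add_le[of "f n - a" "g n - b"] by (simp add: algebra_simps)
  ultimately show ?thesis by (rule tendsto_pnorm_bound[rotated])
qed

lemma padic_tendsto_mult:
  assumes "(f \<longlongrightarrow> (a::'a)) F" "(g \<longlongrightarrow> b) F"
  shows "((\<lambda>n. f n * g n) \<longlongrightarrow> a * b) F"
proof -
  have "((\<lambda>n. pnorm (f n - a) * pnorm (g n - b) + pnorm a * pnorm (g n - b) + pnorm b * pnorm (f n - a))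
      \<longlongrightarrow> 0 * 0 + pnorm a * 0 + pnorm b * 0) F"
    using assms unfolding tendsto_iff_pnorm
    by (intro tendsto_add tendsto_mult tendsto_const)
  then have "((\<lambda>n. pnorm (f n - a) * pnorm (g n - b) + pnorm a * pnorm (g n - b) + pnorm b * pnorm (f n - a))
      \<longlongrightarrow> 0) F" by simp
  moreover have "pnorm (f n * g n - a * b) \<le>
      pnorm (f n - a) * pnorm (g n - b) + pnorm a * pnorm (g n - b) + pnorm b * pnorm (f n - a)" for n
  proof -
    have "f n * g n - a * b = (f n - a) * (g n - b) + a * (g n - b) + b * (f n - a)"
      by (simp add: algebra_simps)
    then show ?thesis
      using pnorm_add_le[of "(f n - a) * (g n - b) + a * (g n - b)" "b * (f n - a)"]
        pnorm_add_le[of "(f n - a) * (g n - b)" "a * (g n - b)"]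
      by (simp add: pnorm_mult)
  qed
  ultimately show ?thesis by (rule tendsto_pnorm_bound[rotated])
qed

lemma padic_tendsto_poly:
  assumes "(f \<longlongrightarrow> (a::'a)) F"
  shows "((\<lambda>n. poly P (f n)) \<longlongrightarrow> poly P a) F"
  by (induction P) (auto intro!: padic_tendsto_add padic_tendsto_mult assms)

section \<open>Density of the integers in the p-adic integers, and integrality of binomial
  coefficients\<close>

lemma pnorm_of_int_coprime:
  assumes "coprime k (int p)"
  shows "pnorm (of_int k::'a) = 1"
proof -
  obtain u v where uv: "u * k + v * int p = 1"
    using assms bezout_int[of k "int p"] by (auto simp: coprime_iff_gcd_eq_1)
  then have eq: "(1::'a) = of_int u * of_int k + of_int v * of_nat p"
    by (metis of_int_1 of_int_add of_int_mult of_int_of_nat_eq)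
  have p: "real p > 1" using prime_gt_1_nat[OF prime_p] by simp
  have "pnorm (of_int v * of_nat p::'a) \<le> 1 * (1 / real p)"
    unfolding pnorm_mult pnorm_p by (intro mult_right_mono pnorm_of_int_le) auto
  also have "\<dots> < 1" using p by simp
  finally have lt: "pnorm (of_int v * of_nat p::'a) < 1" .
  have "1 \<le> pnorm (of_int u * of_int k::'a)"
    using pnorm_ultra[of "of_int u * of_int k" "of_int v * of_nat p", folded eq] lt
    by (auto simp: pnorm_one)
  also have "\<dots> \<le> 1 * pnorm (of_int k::'a)"
    unfolding pnorm_mult by (intro mult_right_mono pnorm_of_int_le) auto
  finally show ?thesis using pnorm_of_int_le[of k] by simp
qed

lemma of_nat_p_power_tendsto: "(\<lambda>N. of_nat (p ^ N) :: 'a) \<longlonglongrightarrow> 0"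
proof -
  have "(\<lambda>N. (1 / real p) ^ N) \<longlonglongrightarrow> 0"
    using prime_gt_1_nat[OF prime_p] by (intro LIMSEQ_power_zero) auto
  then show ?thesis unfolding tendsto_iff_pnorm by (simp add: pnorm_power pnorm_p)
qed

text \<open>In lowest terms, p cannot divide the denominator of a rational of norm at most 1. The
  denominator is then invertible modulo every power of p, which yields integer
  approximations.\<close>

lemma rat_in_closure_Ints:
  assumes "y \<in> \<rat>" "pnorm (y::'a) \<le> 1"
  shows "y \<in> closure \<int>"
proof -
  obtain z where z: "y = of_rat z" using assms(1) Rats_cases by blast
  obtain a b where ab: "quotient_of z = (a, b)" by (cases "quotient_of z")
  have b: "b > 0" "coprime a b" and zab: "z = of_int a / of_int b"
    using ab quotient_of_denom_pos quotient_of_coprime quotient_of_div by auto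
  have y: "y * of_int b = of_int a" using b(1) by (simp add: z zab of_rat_divide)
  have cop: "coprime b (int p)"
  proof (rule ccontr)
    assume "\<not> coprime b (int p)"
    then have pb: "int p dvd b"
      using prime_p by (metis coprime_commute prime_imp_coprime prime_nat_int_transfer)
    then have "\<not> int p dvd a"
      using b(2) prime_p by (metis coprime_common_divisor not_prime_unit prime_nat_int_transfer)
    then have "coprime a (int p)"
      using prime_p by (metis coprime_commute prime_imp_coprime prime_nat_int_transfer)
    then have "pnorm y * pnorm (of_int b::'a) = 1"
      using y pnorm_of_int_coprime by (metis pnorm_mult)
    moreover obtain k where "b = int p * k" using pb by blast
    then have "pnorm (of_int b::'a) \<le> 1 / real p * 1"
      by (simp only: of_int_mult of_int_of_nat_eq pnorm_mult pnorm_p)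
        (intro mult_left_mono pnorm_of_int_le, simp)
    then have "pnorm (of_int b::'a) < 1"
      using prime_gt_1_nat[OF prime_p] by (auto elim!: le_less_trans)
    moreover have "pnorm y * pnorm (of_int b::'a) \<le> 1 * pnorm (of_int b::'a)"
      using assms(2) by (intro mult_right_mono) auto
    ultimately show False by simp
  qed
  \<comment> \<open>The approximant is a times an inverse of b modulo \<open>p ^ N\<close>.\<close>
  have "\<exists>u. pnorm (of_int u - y) \<le> pnorm (of_nat (p ^ N)::'a)" for N
  proof -
    have "coprime b (int (p ^ N))" using cop by simp
    then obtain u v where uv: "u * b + v * int (p ^ N) = 1"
      using bezout_int[of b "int (p ^ N)"] by (auto simp: coprime_iff_gcd_eq_1)
    have "(of_int (u * b + v * int (p ^ N))::'a) = 1" unfolding uv by simp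
    then have "y = y * (of_int u * of_int b + of_int v * of_nat (p ^ N))" by simp
    also have "\<dots> = of_int (u * a) + y * of_int v * of_nat (p ^ N)"
      using y by (simp add: algebra_simps)
    finally have "pnorm (of_int (u * a) - y) = pnorm (y * of_int v * of_nat (p ^ N))"
      using pnorm_diff_commute by (metis add_diff_cancel_left')
    also have "\<dots> \<le> 1 * 1 * pnorm (of_nat (p ^ N)::'a)"
      unfolding pnorm_mult using assms(2) pnorm_of_int_le[of v] by (intro mult_mono) auto
    finally have "pnorm (of_int (u * a) - y) \<le> pnorm (of_nat (p ^ N)::'a)" by (simp only: mult_1)
    then show ?thesis by blast
  qed
  then obtain u where u: "\<And>N. pnorm (of_int (u N) - y) \<le> pnorm (of_nat (p ^ N)::'a)" by metis
  have "(\<lambda>N. of_int (u N)) \<longlonglongrightarrow> y"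
    by (rule tendsto_pnorm_bound[OF u])
      (use of_nat_p_power_tendsto[unfolded tendsto_iff_pnorm] in simp)
  then show ?thesis unfolding closure_sequential by (intro exI[of _ "\<lambda>N. of_int (u N)"]) simp
qed

text \<open>By the ultrametric inequality, rationals at distance less than 1 from y also have norm
  at most 1, so the rational case applies to them.\<close>

lemma Zp_subset_closure_Ints: "(Zp::'a set) \<subseteq> closure \<int>"
proof
  fix y :: 'a assume y: "y \<in> Zp"
  then obtain f where f: "\<And>n. f n \<in> \<rat>" "f \<longlonglongrightarrow> y"
    by (auto simp: Zp_def Qp_def closure_sequential)
  have "eventually (\<lambda>n. dist (f n) y < 1) sequentially"
    using f(2) by (rule tendstoD) simp
  then have "eventually (\<lambda>n. f n \<in> closure \<int>) sequentially"
  proof eventually_elim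
    case (elim n)
    have "pnorm (f n) \<le> 1"
      using pnorm_ultra[of "f n - y" y] elim[unfolded dist_diff[of "f n" y]] y
      by (auto simp: Zp_def)
    then show ?case using f(1) by (intro rat_in_closure_Ints)
  qed
  then show "y \<in> closure \<int>"
    using f(2) by (intro Lim_in_closed_set[of "closure \<int>"]) auto
qed

lemma of_int_in_Zp: "(of_int k::'a) \<in> Zp"
  using subsetD[OF closure_subset Rats_of_int] by (simp add: Zp_def Qp_def pnorm_of_int_le)

lemma Zp_plus_of_nat:
  assumes "(y::'a) \<in> Zp"
  shows "y + of_nat m \<in> Zp"
proof -
  obtain f where f: "\<And>n. f n \<in> \<rat>" "f \<longlonglongrightarrow> y"
    using assms by (auto simp: Zp_def Qp_def closure_sequential)
  have "(\<lambda>n. f n + of_nat m) \<longlonglongrightarrow> y + of_nat m"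
    using f(2) by (intro padic_tendsto_add) auto
  then have "y + of_nat m \<in> Qp"
    using f(1) unfolding Qp_def closure_sequential by (intro exI[of _ "\<lambda>n. f n + of_nat m"]) auto
  moreover have "pnorm (y + of_nat m) \<le> 1"
    using pnorm_ultra[of y "of_nat m"] assms pnorm_of_nat_le[of m] by (auto simp: Zp_def)
  ultimately show ?thesis by (simp add: Zp_def)
qed

text \<open>At integer arguments the binomial coefficient is an integer. The bound extends to the
  closure because the coefficient is a polynomial in y.\<close>

lemma pnorm_gbinomial_le:
  assumes "(y::'a) \<in> Zp"
  shows "pnorm (y gchoose n) \<le> 1"
proof -
  obtain f where f: "\<And>n. f n \<in> \<int>" "f \<longlonglongrightarrow> y"
    using subsetD[OF Zp_subset_closure_Ints assms] unfolding closure_sequential by blast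
  define B :: "'a poly" where "B = smult (inverse (fact n)) (\<Prod>i=0..<n. [:- of_nat i, 1:])"
  have B: "poly B z = z gchoose n" for z
    by (simp add: B_def gbinomial_prod_rev poly_prod divide_inverse mult.commute)
  have "(\<lambda>k. pnorm (poly B (f k))) \<longlonglongrightarrow> pnorm (poly B y)"
    using padic_tendsto_poly[OF f(2)] by (intro tendsto_dist) auto
  moreover have "pnorm (poly B (f k)) \<le> 1" for k
  proof -
    obtain i where "f k = of_int i" using f(1) Ints_cases by blast
    then show ?thesis using pnorm_of_int_le by (simp add: B flip: of_int_gbinomial)
  qed
  ultimately show ?thesis unfolding B[symmetric] by (intro LIMSEQ_le_const2) auto
qed

section \<open>Convergence of series and the power function \<open>zpow\<close>\<close>

lemma padic_sums_of_null:
  assumes "(f::nat \<Rightarrow> 'a) \<longlonglongrightarrow> 0"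
  shows "f sums suminf f"
proof -
  have "Cauchy (\<lambda>n. \<Sum>i<n. f i)"
  proof (rule metric_CauchyI)
    fix e :: real assume e: "0 < e"
    \<comment> \<open>The ultrametric inequality bounds a block of terms by its largest one, so null
      terms suffice. Half of e leaves room for a strict inequality.\<close>
    then have "eventually (\<lambda>n. dist (f n) 0 < e / 2) sequentially"
      using assms by (intro tendstoD) auto
    then obtain K where K: "\<And>n. n \<ge> K \<Longrightarrow> pnorm (f n) < e / 2"
      by (auto simp: eventually_sequentially)
    have le: "dist (\<Sum>i<m. f i) (\<Sum>i<n. f i) \<le> e / 2" if "K \<le> m" "m \<le> n" for m n
    proof -
      have "(\<Sum>i<n. f i) - (\<Sum>i<m. f i) = (\<Sum>i\<in>{m..<n}. f i)"
        using that by (simp add: sum_diff_nat_ivl flip: atLeast0LessThan)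
      moreover have "pnorm (\<Sum>i\<in>{m..<n}. f i) \<le> e / 2"
        using K that e by (intro pnorm_sum_le) (force intro: less_imp_le)+
      ultimately show ?thesis by (metis dist_commute dist_diff)
    qed
    have "dist (\<Sum>i<m. f i) (\<Sum>i<n. f i) < e" if "K \<le> m" "K \<le> n" for m n
      using le[of m n] le[of n m] that e by (cases "m \<le> n") (auto simp: dist_commute)
    then show "\<exists>K. \<forall>m\<ge>K. \<forall>n\<ge>K. dist (\<Sum>i<m. f i) (\<Sum>i<n. f i) < e" by blast
  qed
  then have "\<exists>s. f sums s"
    by (simp add: Cauchy_convergent_iff convergent_def sums_def)
  then show ?thesis by (metis sums_unique)
qed

lemma zpow_sums:
  assumes "(y::'a) \<in> Zp" "pnorm (1 - a) < 1"
  shows "(\<lambda>n. (y gchoose n) * (a - 1) ^ n) sums zpow a y"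
  unfolding zpow_def
proof (rule padic_sums_of_null)
  have "(\<lambda>n. pnorm (a - 1) ^ n) \<longlonglongrightarrow> 0"
    using assms(2) by (intro LIMSEQ_power_zero) (auto simp: pnorm_diff_commute)
  moreover have "pnorm ((y gchoose n) * (a - 1) ^ n) \<le> pnorm (a - 1) ^ n" for n
    unfolding pnorm_mult pnorm_power
    using mult_right_mono[OF pnorm_gbinomial_le[OF assms(1), of n], of "pnorm (a - 1) ^ n"] by simp
  ultimately show "(\<lambda>n. (y gchoose n) * (a - 1) ^ n) \<longlonglongrightarrow> 0"
    by (intro tendsto_pnorm_bound[where g = "\<lambda>n. pnorm (a - 1) ^ n"]) auto
qed

lemma zpow_plus_one:
  assumes "(y::'a) \<in> Zp" "pnorm (1 - a) < 1"
  shows "zpow a (y + 1) = a * zpow a y"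
proof -
  define S where "S y n = (\<Sum>i<n. (y gchoose i) * (a - 1) ^ i)" for y n
  have S: "S y \<longlonglongrightarrow> zpow a y" if "y \<in> Zp" for y
    using zpow_sums[OF that assms(2)] unfolding S_def sums_def .
  have y1: "y + 1 \<in> Zp" using Zp_plus_of_nat[OF assms(1), of 1] by simp
  \<comment> \<open>Pascal's rule, summed over the partial sums of the binomial series.\<close>
  have "S (y + 1) (Suc n) = S y (Suc n) + (a - 1) * S y n" for n
  proof (induction n)
    case (Suc n)
    have "S (y + 1) (Suc (Suc n)) = S (y + 1) (Suc n) + (y + 1 gchoose Suc n) * (a - 1) ^ Suc n"
      by (simp add: S_def)
    also have "\<dots> = S y (Suc (Suc n)) + (a - 1) * S y (Suc n)"
      unfolding Suc gbinomial_Suc_Suc by (simp add: S_def algebra_simps)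
    finally show ?case .
  qed (simp add: S_def)
  moreover have "(\<lambda>n. S y (Suc n) + (a - 1) * S y n) \<longlonglongrightarrow> zpow a y + (a - 1) * zpow a y"
    by (intro padic_tendsto_add padic_tendsto_mult tendsto_const
        LIMSEQ_Suc[OF S[OF assms(1)]] S[OF assms(1)])
  moreover have "(\<lambda>n. S (y + 1) (Suc n)) \<longlonglongrightarrow> zpow a (y + 1)"
    using S[OF y1] by (rule LIMSEQ_Suc)
  ultimately have "zpow a (y + 1) = zpow a y + (a - 1) * zpow a y"
    by (simp add: LIMSEQ_unique)
  then show ?thesis by (simp add: algebra_simps)
qed

text \<open>Integer exponents are needed because \<open>h - i + 1\<close> may be negative.\<close>

lemma zpow_of_int:
  assumes "pnorm (1 - a::'a) < 1"
  shows "zpow a (of_int k) = a powi k"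
proof -
  have a: "a \<noteq> 0" using assms by (auto simp: pnorm_one)
  show ?thesis
  proof (induction k rule: int_induct[of _ 0])
    case base
    show ?case using zpow_of_nat[of a 0] by simp
  next
    case (step1 i)
    then show ?case using a zpow_plus_one[OF of_int_in_Zp assms, of i] by (simp add: power_int_add)
  next
    case (step2 i)
    then have "a * zpow a (of_int (i - 1)) = a powi i"
      using zpow_plus_one[OF of_int_in_Zp assms, of "i - 1"] by simp
    then show ?case using a by (simp add: power_int_diff field_simps)
  qed
qed

lemma qnum_plus_one:
  assumes "(y::'a) \<in> Zp" "pnorm (1 - q) < 1"
  shows "qnum q (y + 1) = 1 + q * qnum q y"
  using zpow_plus_one[OF assms] by (auto simp: qnum_def field_simps)

lemma zpow_plus_of_nat:
  assumes "(y::'a) \<in> Zp" "pnorm (1 - a) < 1"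
  shows "zpow a (y + of_nat m) = a ^ m * zpow a y"
proof (induction m)
  case (Suc m)
  have "zpow a (y + of_nat (Suc m)) = zpow a ((y + of_nat m) + 1)" by (simp add: add_ac)
  then show ?case using Suc zpow_plus_one[OF Zp_plus_of_nat[OF assms(1)] assms(2)] by simp
qed simp

section \<open>Limits along the powers of p\<close>

lemma one_unit_p_power_tendsto:
  assumes "pnorm (1 - c::'a) < 1"
  shows "(\<lambda>N. c ^ (p ^ N)) \<longlonglongrightarrow> 1"
proof -
  \<comment> \<open>The rate s dominates both the norm of p and that of c - 1. Each p-th power gains
    a factor s, because d ^ p - 1 is (d - 1) times a sum of p powers of d, and this sum is within s
    of p.\<close>
  define s where "s = max (1 / real p) (pnorm (c - 1))"
  have s: "0 \<le> s" "s < 1"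
    using assms prime_gt_1_nat[OF prime_p] by (auto simp: s_def pnorm_diff_commute max_def)
  have gp: "d ^ n - 1 = (d - 1) * (\<Sum>i<n. d ^ i)" for d :: 'a and n
    using power_diff_1_eq[of d n] by (cases n) auto
  have unit: "pnorm (d ^ n - 1) \<le> s" if d: "pnorm (d - 1) \<le> s" for d :: 'a and n
  proof (induction n)
    case (Suc n)
    have d1: "pnorm d \<le> 1" using pnorm_ultra[of "d - 1" 1] d s by (simp add: pnorm_one)
    have "d ^ Suc n - 1 = d * (d ^ n - 1) + (d - 1)" by (simp add: algebra_simps)
    moreover have "pnorm (d * (d ^ n - 1)) \<le> s"
      using mult_mono[OF d1 Suc] by (simp add: pnorm_mult)
    ultimately show ?case using order_trans[OF pnorm_ultra max.boundedI[OF _ d]] by metis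
  qed (use s in simp)
  have "pnorm (c ^ (p ^ N) - 1) \<le> s ^ Suc N" for N
  proof (induction N)
    case 0
    show ?case by (simp add: s_def)
  next
    case (Suc N)
    define d where "d = c ^ (p ^ N)"
    have d: "pnorm (d - 1) \<le> s" unfolding d_def by (rule unit) (simp add: s_def)
    have "(\<Sum>i<p. d ^ i) = (\<Sum>i<p. d ^ i - 1) + of_nat p" by (simp add: sum_subtractf)
    moreover have "pnorm (\<Sum>i<p. d ^ i - 1) \<le> s" using unit[OF d] s by (intro pnorm_sum_le)
    ultimately have "pnorm (\<Sum>i<p. d ^ i) \<le> s"
      using pnorm_ultra[of "\<Sum>i<p. d ^ i - 1" "of_nat p"] by (simp add: pnorm_p s_def)
    then have "pnorm (d - 1) * pnorm (\<Sum>i<p. d ^ i) \<le> s ^ Suc N * s"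
      using Suc s unfolding d_def by (intro mult_mono) auto
    then have "pnorm (d ^ p - 1) \<le> s ^ Suc N * s" unfolding gp pnorm_mult .
    then show ?case by (simp add: d_def power_mult[symmetric] mult_ac)
  qed
  moreover have "(\<lambda>N. s ^ Suc N) \<longlonglongrightarrow> 0" using s by (intro LIMSEQ_Suc[OF LIMSEQ_power_zero]) auto
  ultimately show ?thesis by (rule tendsto_pnorm_bound)
qed

text \<open>This gives the limit of the boundary term of the telescoping sums. For q = 1 it rests on
  \<open>p ^ N\<close> tending to 0, otherwise on \<open>q ^ (p ^ N)\<close> tending to 1.\<close>

lemma qnum_plus_p_power_tendsto:
  assumes "(y::'a) \<in> Zp" "pnorm (1 - q) < 1"
  shows "(\<lambda>N. qnum q (y + of_nat (p ^ N))) \<longlonglongrightarrow> qnum q y"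
proof (cases "q = 1")
  case True
  have "(\<lambda>N. y + of_nat (p ^ N)) \<longlonglongrightarrow> y + 0"
    by (intro padic_tendsto_add tendsto_const of_nat_p_power_tendsto)
  then show ?thesis by (simp add: True qnum_def)
next
  case False
  have "(\<lambda>N. 1 / (1 - q) + (- zpow q y / (1 - q)) * q ^ (p ^ N))
      \<longlonglongrightarrow> 1 / (1 - q) + (- zpow q y / (1 - q)) * 1"
    by (intro padic_tendsto_add padic_tendsto_mult tendsto_const one_unit_p_power_tendsto assms)
  moreover have "1 / (1 - q) + (- zpow q y / (1 - q)) * q ^ m = qnum q (y + of_nat m)" for m
    using False zpow_plus_of_nat[OF assms] by (simp add: qnum_def diff_divide_distrib mult_ac)
  moreover have "1 / (1 - q) + (- zpow q y / (1 - q)) * 1 = qnum q y"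
    using False by (simp add: qnum_def diff_divide_distrib)
  ultimately show ?thesis by simp
qed

section \<open>The group of one-units\<close>

lemma one_unit_mult:
  assumes "pnorm (1 - a::'a) < 1" "pnorm (1 - b) < 1"
  shows "pnorm (1 - a * b) < 1"
proof -
  have "pnorm a \<le> 1" using pnorm_ultra_diff[of 1 "1 - a"] assms(1) by (simp add: pnorm_one)
  then have le: "pnorm (a * (1 - b)) \<le> 1 * pnorm (1 - b)"
    unfolding pnorm_mult by (intro mult_right_mono) auto
  have "1 - a * b = (1 - a) + a * (1 - b)" by (simp add: algebra_simps)
  then have "pnorm (1 - a * b) \<le> max (pnorm (1 - a)) (pnorm (a * (1 - b)))"
    using pnorm_ultra by metis
  then show ?thesis using assms le by simp
qed

lemma one_unit_nonzero: "pnorm (1 - a::'a) < 1 \<Longrightarrow> a \<noteq> 0"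
  by (auto simp: pnorm_one)

lemma one_unit_inverse:
  assumes "pnorm (1 - a::'a) < 1"
  shows "pnorm (1 - inverse a) < 1"
proof -
  have "1 \<le> pnorm a" using pnorm_ultra[of "1 - a" a] assms by (simp add: pnorm_one)
  moreover have "a * (1 - inverse a) = a - 1"
    using one_unit_nonzero[OF assms] by (simp add: algebra_simps)
  then have "pnorm a * pnorm (1 - inverse a) = pnorm (1 - a)"
    by (metis pnorm_mult pnorm_diff_commute)
  ultimately show ?thesis
    using assms mult_right_mono[of 1 "pnorm a" "pnorm (1 - inverse a)"] by simp
qed

lemma one_unit_power: "pnorm (1 - a::'a) < 1 \<Longrightarrow> pnorm (1 - a ^ n) < 1"
  by (induction n) (auto intro: one_unit_mult)

lemma one_unit_power_int: "pnorm (1 - a::'a) < 1 \<Longrightarrow> pnorm (1 - a powi k) < 1"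
  by (auto simp: power_int_def intro: one_unit_power one_unit_inverse)

text \<open>If c were -1, then 1 - c would be 2, which has norm 1 for odd p.\<close>

lemma one_plus_one_unit_nonzero:
  assumes "odd p" "pnorm (1 - c::'a) < 1"
  shows "1 + c \<noteq> 0"
proof
  assume "1 + c = 0"
  then have "c = - 1" by (simp add: eq_neg_iff_add_eq_0 add.commute)
  then have "1 - c = of_int 2" by simp
  moreover have "pnorm (of_int 2::'a) = 1" by (rule pnorm_of_int_coprime) (use assms(1) in simp)
  ultimately have "pnorm (1 - c) = 1" by metis
  then show False using assms(2) by simp
qed

end

subsection \<open>The shift operator on polynomials\<close>

abbreviation qshift :: "'a::field \<Rightarrow> 'a poly \<Rightarrow> 'a poly"
  where "qshift q P \<equiv> pcompose P [:1, q:]"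

definition shift_op :: "'a::field \<Rightarrow> 'a \<Rightarrow> 'a poly \<Rightarrow> 'a poly"
  where "shift_op q c P = P + smult c (qshift q P)"

text \<open>This is the triangularity of the shift: the degree is preserved and the leading
  coefficient scales by a power of q. The bound n replaces the degree so that P may have smaller
  degree or be 0 in the inductions below.\<close>

lemma coeff_qshift:
  fixes q :: "'a::field"
  assumes "q \<noteq> 0" "\<And>i. i > n \<Longrightarrow> coeff P i = 0" "n \<le> i"
  shows "coeff (qshift q P) i = q ^ i * coeff P i"
proof -
  have deg: "degree (qshift q P) = degree P" using assms(1) by (simp add: degree_pcompose)
  have "degree P \<le> n" using assms(2) by (intro degree_le) auto
  then consider "i = degree P" | "i > degree P" using assms(3) by linarith
  then show ?thesis
  proof cases
    case 1
    have "lead_coeff (qshift q P) = lead_coeff P * lead_coeff [:1, q:] ^ degree P"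
      using assms(1) by (intro lead_coeff_comp) simp
    then show ?thesis using 1 deg assms(1) by simp
  next
    case 2
    then show ?thesis using deg by (simp add: coeff_eq_0)
  qed
qed

lemma shift_op_surj:
  fixes q c :: "'a::field"
  assumes "q \<noteq> 0" "\<And>n. 1 + c * q ^ n \<noteq> 0"
  shows "\<exists>G. shift_op q c G = P"
proof -
  have "\<exists>G. shift_op q c G = P" if "\<And>i. i \<ge> n \<Longrightarrow> coeff P i = 0" for n
    using that
  proof (induction n arbitrary: P)
    case 0
    then have "P = 0" by (simp add: poly_eq_iff)
    then show ?case by (intro exI[of _ 0]) (simp add: shift_op_def)
  next
    case (Suc n)
    \<comment> \<open>Subtracting the image of \<open>smult b P\<close> cancels the coefficient of
      index n, the highest that may be nonzero.\<close>
    define b where "b = 1 / (1 + c * q ^ n)"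
    have b: "b + b * (c * q ^ n) = 1"
      using assms(2)[of n] by (simp add: b_def add_divide_distrib[symmetric])
    have "coeff (P - shift_op q c (smult b P)) i = 0" if i: "i \<ge> n" for i
    proof -
      have "coeff (qshift q P) i = q ^ i * coeff P i"
        using assms(1) Suc.prems i by (intro coeff_qshift) auto
      then have "coeff (P - shift_op q c (smult b P)) i = (1 - (b + b * (c * q ^ i))) * coeff P i"
        by (simp add: shift_op_def pcompose_smult algebra_simps)
      then show ?thesis using b Suc.prems[of i] i by (cases "i = n") auto
    qed
    then obtain G where "shift_op q c G = P - shift_op q c (smult b P)" using Suc.IH by blast
    then have "shift_op q c (G + smult b P) = P"
      by (simp add: shift_op_def pcompose_add pcompose_smult smult_add_right algebra_simps)
    then show ?case by blast
  qed
  from this[of "Suc (degree P)"] show ?thesis by (auto simp: coeff_eq_0)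
qed

lemma shift_op_commute: "shift_op q c (shift_op q d P) = shift_op q d (shift_op q c P)"
  by (simp add: shift_op_def pcompose_add pcompose_smult smult_add_right mult.commute)

primrec shift_ops :: "'a::field \<Rightarrow> (nat \<Rightarrow> 'a) \<Rightarrow> nat \<Rightarrow> 'a poly \<Rightarrow> 'a poly" where
  "shift_ops q c 0 P = P"
| "shift_ops q c (Suc r) P = shift_op q (c (Suc r)) (shift_ops q c r P)"

text \<open>The recursion puts the last factor outermost, as the series needs it. The iterated
  integral needs it next to the polynomial, since its variable is integrated last.\<close>

lemma shift_ops_commute: "shift_op q d (shift_ops q c r P) = shift_ops q c r (shift_op q d P)"
  by (induction r) (simp_all add: shift_op_commute[of q d])

lemma shift_ops_surj:
  fixes q :: "'a::field"
  assumes "q \<noteq> 0" "\<And>i n. 1 + c i * q ^ n \<noteq> 0"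
  shows "\<exists>G. shift_ops q c r G = P"
proof (induction r arbitrary: P)
  case (Suc r)
  obtain H where "shift_op q (c (Suc r)) H = P" using shift_op_surj assms by blast
  then show ?case using Suc[of H] by auto
qed simp

subsection \<open>Gaussian binomial coefficients and regularized sums\<close>

text \<open>Split [n+1] as [n-k] + q^(n-k) [k+1] in the numerator. The cancellation takes place
  between polynomials, because the q-factorial may vanish at a root of unity.\<close>

lemma qbinom_Suc_Suc:
  assumes "k \<le> n"
  shows "qbinom (Suc n) (Suc k) q = qbinom n (Suc k) q + q ^ (n - k) * qbinom n k (q::'a::field_char_0)"
proof -
  let ?P = "\<lambda>n k. \<Prod>i<k. qnum_poly (n - i) :: 'a poly"
  let ?F = "\<lambda>k. \<Prod>i=1..k. qnum_poly i :: 'a poly"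
  \<comment> \<open>At 1 the polynomial takes the value i, nonzero in characteristic 0.\<close>
  have nz: "qnum_poly i \<noteq> (0::'a poly)" if "i > 0" for i
  proof
    assume "qnum_poly i = (0::'a poly)"
    then have "poly (qnum_poly i) (1::'a) = 0" by simp
    then show False using that by (simp add: qnum_poly_def poly_sum poly_monom)
  qed
  have F0: "?F j \<noteq> 0" for j using nz by (simp add: prod_zero_iff)
  have F: "?F (Suc k) = qnum_poly (Suc k) * ?F k" by (simp add: mult.commute)
  have P: "?P (Suc n) (Suc k) = qnum_poly (Suc n) * ?P n k"
    by (simp add: prod.lessThan_Suc_shift del: prod.lessThan_Suc)
  have split: "qnum_poly (Suc n) = qnum_poly (n - k) + monom 1 (n - k) * (qnum_poly (Suc k) :: 'a poly)"
    using assms by (simp flip: qnum_poly_add)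
  define D where "D n k = ?P n k div ?F k" for n k
  have D: "?P n k = D n k * ?F k" for n k
    unfolding D_def by (rule dvd_div_mult_self[OF qfact_poly_dvd, symmetric])
  have "D (Suc n) (Suc k) * ?F (Suc k) = ?P n (Suc k) + monom 1 (n - k) * qnum_poly (Suc k) * ?P n k"
    unfolding D[symmetric] P split by (simp add: algebra_simps)
  also have "\<dots> = (D n (Suc k) + monom 1 (n - k) * D n k) * ?F (Suc k)"
    unfolding D F by (simp add: algebra_simps)
  finally have "D (Suc n) (Suc k) = D n (Suc k) + monom 1 (n - k) * D n k"
    using F0[of "Suc k"] by (simp only: mult_cancel_right) blast
  then show ?thesis unfolding qbinom_def D_def[symmetric] by (simp add: poly_monom)
qed

lemma qbinom_0_right [simp]: "qbinom n 0 q = 1"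
  by (simp add: qbinom_def)

lemma qbinom_less: "n < k \<Longrightarrow> qbinom n k q = 0"
  by (subst qbinom_def, subst prod_zero) (auto simp: qnum_poly_def intro!: bexI[of _ n])

section \<open>Rules for regularized sums\<close>

lemma reg_sumsI:
  assumes "fps_of_poly Q * Abs_fps a = fps_of_poly P" "poly Q 1 \<noteq> 0" "s = poly P 1 / poly Q 1"
  shows "reg_sums a s"
  using assms unfolding reg_sums_def by blast

lemma reg_sums_add:
  assumes "reg_sums a s" "reg_sums b t"
  shows "reg_sums (\<lambda>m. a m + b m) (s + t)"
proof -
  obtain P Q where 1: "fps_of_poly Q * Abs_fps a = fps_of_poly P" "poly Q 1 \<noteq> 0"
    "s = poly P 1 / poly Q 1" using assms(1) unfolding reg_sums_def by blast
  obtain P' Q' where 2: "fps_of_poly Q' * Abs_fps b = fps_of_poly P'" "poly Q' 1 \<noteq> 0"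
    "t = poly P' 1 / poly Q' 1" using assms(2) unfolding reg_sums_def by blast
  have "Abs_fps (\<lambda>m. a m + b m) = Abs_fps a + Abs_fps b" by (simp add: fps_eq_iff)
  then have "fps_of_poly (Q * Q') * Abs_fps (\<lambda>m. a m + b m) =
      fps_of_poly Q' * (fps_of_poly Q * Abs_fps a) + fps_of_poly Q * (fps_of_poly Q' * Abs_fps b)"
    by (simp add: fps_of_poly_mult algebra_simps)
  then have "fps_of_poly (Q * Q') * Abs_fps (\<lambda>m. a m + b m) = fps_of_poly (Q' * P + Q * P')"
    unfolding 1(1) 2(1) by (simp add: fps_of_poly_mult fps_of_poly_add)
  moreover have "s + t = poly (Q' * P + Q * P') 1 / poly (Q * Q') 1"
    unfolding 1(3) 2(3) using 1(2) 2(2) by (simp add: add_frac_eq mult.commute)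
  ultimately show ?thesis using 1(2) 2(2) by (intro reg_sumsI[of "Q * Q'" _ "Q' * P + Q * P'"]) auto
qed

text \<open>Only the numerator changes, by the factor U. Taking U = z shows that shifting the index
  leaves the sum unchanged, since U(1) = 1.\<close>

lemma reg_sums_poly_mult:
  assumes "reg_sums a s"
  shows "reg_sums (fps_nth (fps_of_poly U * Abs_fps a)) (poly U 1 * s)"
proof -
  obtain P Q where 1: "fps_of_poly Q * Abs_fps a = fps_of_poly P" "poly Q 1 \<noteq> 0"
    "s = poly P 1 / poly Q 1" using assms unfolding reg_sums_def by blast
  have "fps_of_poly Q * (fps_of_poly U * Abs_fps a) = fps_of_poly U * (fps_of_poly Q * Abs_fps a)"
    by (simp add: mult_ac)
  also have "\<dots> = fps_of_poly (U * P)" unfolding 1(1) by (simp add: fps_of_poly_mult)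
  finally show ?thesis
    using 1(2,3) by (intro reg_sumsI[of Q _ "U * P"]) (simp_all add: fps_nth_inverse)
qed

lemma reg_sums_cmult:
  assumes "reg_sums a s"
  shows "reg_sums (\<lambda>m. c * a m) (c * s)"
proof -
  have "fps_nth (fps_of_poly [:c:] * Abs_fps a) = (\<lambda>m. c * a m)"
    by (simp add: fun_eq_iff fps_of_poly_const)
  then show ?thesis using reg_sums_poly_mult[OF assms, of "[:c:]"] by simp
qed

lemma reg_sums_shift:
  assumes "reg_sums a s"
  shows "reg_sums (\<lambda>m. if m = 0 then 0 else a (m - 1)) s"
proof -
  have "fps_nth (fps_of_poly [:0, 1:] * Abs_fps a) = (\<lambda>m. if m = 0 then 0 else a (m - 1))"
    by (simp add: fun_eq_iff fps_of_poly_pCons)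
  then show ?thesis using reg_sums_poly_mult[OF assms, of "[:0, 1:]"] by simp
qed

text \<open>Division of the generating function by \<open>1 + d z\<close>.\<close>

lemma reg_sums_linear_cancel:
  assumes "reg_sums a s" "1 + d \<noteq> 0" "\<And>m. b m + (if m = 0 then 0 else d * b (m - 1)) = a m"
  shows "reg_sums b (s / (1 + d))"
proof -
  obtain P Q where 1: "fps_of_poly Q * Abs_fps a = fps_of_poly P" "poly Q 1 \<noteq> 0"
    "s = poly P 1 / poly Q 1" using assms(1) unfolding reg_sums_def by blast
  have "Abs_fps a = fps_of_poly [:1, d:] * Abs_fps b"
    by (rule fps_ext) (simp add: fps_of_poly_pCons assms(3)[symmetric] algebra_simps)
  then have "fps_of_poly (Q * [:1, d:]) * Abs_fps b = fps_of_poly P"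
    using 1(1) by (simp only: fps_of_poly_mult mult.assoc)
  then show ?thesis
    by (rule reg_sumsI)
      (use 1(2,3) assms(2) in \<open>simp_all only: poly_mult poly_pCons poly_0, simp_all\<close>)
qed

text \<open>The summands of the generating function, with \<open>k = q\<^sup>h w\<close> and \<open>Y m = [m + x]\<close>.\<close>

definition qseries :: "nat \<Rightarrow> 'a::field_char_0 \<Rightarrow> 'a \<Rightarrow> (nat \<Rightarrow> 'a) \<Rightarrow> 'a poly \<Rightarrow> nat \<Rightarrow> 'a"
  where "qseries r q k Y P m = qbinom (m + r - 1) m (inverse q) * (- k) ^ m * poly P (Y m)"

text \<open>Truncated subtraction matters: the upper index \<open>m + 0 - 1\<close> is below m for m
  > 0, but for m = 0 it is 0 and the coefficient is 1.\<close>

lemma qseries_0: "qseries 0 q k Y P m = (if m = 0 then poly P (Y 0) else 0)"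
  by (simp add: qseries_def qbinom_less)

lemma qseries_0_reg_sums: "reg_sums (qseries 0 q k Y P) (poly P (Y 0))"
  by (rule reg_sumsI[of 1 _ "[:poly P (Y 0):]"])
    (simp_all add: fps_eq_iff qseries_0 coeff_pCons split: nat.split)

lemma qseries_add: "qseries r q k Y (P + G) m = qseries r q k Y P m + qseries r q k Y G m"
  by (simp add: qseries_def algebra_simps)

lemma qseries_smult: "qseries r q k Y (smult a P) m = a * qseries r q k Y P m"
  by (simp add: qseries_def algebra_simps)

text \<open>The q-Pascal rule in base 1/q splits the coefficient. In its second part the index drops
  by one, which the shift of P compensates.\<close>

lemma qseries_Suc:
  assumes "\<And>m. Y (Suc m) = 1 + q * Y m" and "c = k * inverse q ^ r"
  shows "qseries (Suc r) q k Y P m =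
    qseries r q k Y P m + (if m = 0 then 0 else - c * qseries (Suc r) q k Y (qshift q P) (m - 1))"
proof (cases m)
  case 0
  then show ?thesis by (simp add: qseries_def)
next
  case (Suc l)
  have "poly (qshift q P) (Y l) = poly P (Y m)" by (simp add: poly_pcompose Suc assms(1) mult.commute)
  moreover have "qbinom (Suc (l + r)) (Suc l) (inverse q) =
      qbinom (l + r) (Suc l) (inverse q) + inverse q ^ r * qbinom (l + r) l (inverse q)"
    using qbinom_Suc_Suc[of l "l + r" "inverse q"] by simp
  ultimately show ?thesis by (simp add: qseries_def Suc assms(2) algebra_simps)
qed

text \<open>Induction on r and, inside it, on a degree bound. Up to its diagonal part, the shift of
  P lowers the bound, so the recursion expresses the series times a linear factor 1 + d z through
  summable series.\<close>

lemma qseries_reg_summable: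
  fixes q k :: "'a::field_char_0"
  assumes Y: "\<And>m. Y (Suc m) = 1 + q * Y m" and q: "q \<noteq> 0"
    and nz: "\<And>r n. 1 + k * inverse q ^ r * q ^ n \<noteq> 0"
  shows "\<exists>s. reg_sums (qseries r q k Y P) s"
proof (induction r arbitrary: P)
  case 0
  show ?case using qseries_0_reg_sums by blast
next
  case (Suc r)
  let ?c = "k * inverse q ^ r"
  have "\<exists>s. reg_sums (qseries (Suc r) q k Y P) s" if "\<And>i. i \<ge> n \<Longrightarrow> coeff P i = 0" for n
    using that
  proof (induction n arbitrary: P)
    case 0
    then have "P = 0" by (simp add: poly_eq_iff)
    then have "qseries (Suc r) q k Y P = (\<lambda>m. 0 * qseries (Suc r) q k Y P m)"
      by (simp add: fun_eq_iff qseries_def)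
    moreover have "reg_sums (\<lambda>m. 0) (0::'a)"
      by (rule reg_sumsI[of 1 _ 0]) (simp_all add: fps_eq_iff)
    ultimately show ?case by auto
  next
    case (Suc n)
    \<comment> \<open>Removing the diagonal entry \<open>q ^ n\<close> kills the coefficient of
      index n.\<close>
    define R where "R = qshift q P - smult (q ^ n) P"
    have "coeff R i = 0" if "i \<ge> n" for i
    proof -
      have "coeff (qshift q P) i = q ^ i * coeff P i"
        using q Suc.prems that by (intro coeff_qshift) auto
      then show ?thesis using Suc.prems[of i] that by (cases "i = n") (auto simp: R_def)
    qed
    then obtain s where s: "reg_sums (qseries (Suc r) q k Y R) s" using Suc.IH by blast
    obtain t where t: "reg_sums (qseries r q k Y P) t"
      using \<open>\<And>P. \<exists>s. reg_sums (qseries r q k Y P) s\<close> by blast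
    have "reg_sums (\<lambda>m. qseries r q k Y P m +
        - ?c * (if m = 0 then 0 else qseries (Suc r) q k Y R (m - 1))) (t + - ?c * s)"
      by (intro reg_sums_add reg_sums_cmult reg_sums_shift s t)
    moreover have "qseries (Suc r) q k Y P m +
        (if m = 0 then 0 else ?c * q ^ n * qseries (Suc r) q k Y P (m - 1)) =
        qseries r q k Y P m + - ?c * (if m = 0 then 0 else qseries (Suc r) q k Y R (m - 1))" for m
    proof -
      have "qshift q P = R + smult (q ^ n) P" by (simp add: R_def)
      then show ?thesis
        by (subst qseries_Suc[of Y, OF Y refl]) (simp add: qseries_add qseries_smult algebra_simps)
    qed
    ultimately show ?case using reg_sums_linear_cancel[OF _ nz] by blast
  qed
  from this[of "Suc (degree P)"] show ?case by (auto simp: coeff_eq_0)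
qed

lemma qseries_reg_sums_shift_ops:
  fixes q k :: "'a::field_char_0"
  assumes Y: "\<And>m. Y (Suc m) = 1 + q * Y m" and q: "q \<noteq> 0"
    and nz: "\<And>r n. 1 + k * inverse q ^ r * q ^ n \<noteq> 0"
    and c: "\<And>i. c (Suc i) = k * inverse q ^ i"
  shows "reg_sums (qseries r q k Y (shift_ops q c r G)) (poly G (Y 0))"
proof (induction r)
  case 0
  show ?case by (simp add: qseries_0_reg_sums)
next
  case (Suc r)
  define P where "P = shift_ops q c r G"
  let ?S = "qseries (Suc r) q k Y"
  let ?c = "k * inverse q ^ r"
  obtain s where s: "reg_sums (?S (shift_op q ?c P)) s"
    using qseries_reg_summable[of Y, OF Y q nz] by blast
  obtain t where t: "reg_sums (?S (qshift q P)) t"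
    using qseries_reg_summable[of Y, OF Y q nz] by blast
  \<comment> \<open>The added terms have sum 0 because a shift preserves the regularized sum. They
    turn the series for \<open>Suc r\<close> into the one for r, whose sum is known, and uniqueness
    then determines s.\<close>
  have "reg_sums (\<lambda>m. ?S (shift_op q ?c P) m +
      (- ?c * ?S (qshift q P) m + ?c * (if m = 0 then 0 else ?S (qshift q P) (m - 1))))
      (s + (- ?c * t + ?c * t))"
    by (intro reg_sums_add reg_sums_cmult reg_sums_shift s t)
  moreover have "?S (shift_op q ?c P) m +
      (- ?c * ?S (qshift q P) m + ?c * (if m = 0 then 0 else ?S (qshift q P) (m - 1))) =
      qseries r q k Y P m" for m
    by (simp add: shift_op_def qseries_add qseries_smult qseries_Suc[of Y, OF Y refl, of r k P])
  ultimately have "reg_sums (qseries r q k Y P) s" by simp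
  then have "s = poly G (Y 0)" using Suc reg_sums_unique unfolding P_def by blast
  then show ?case using s by (simp add: c P_def)
qed

subsection \<open>Fermionic integrals\<close>

lemma fermionic_integral_cong:
  assumes "\<And>m. f (of_nat m) = g (of_nat m)"
  shows "fermionic_integral p f = fermionic_integral p g"
  unfolding fermionic_integral_def assms ..

text \<open>The integrals sample their integrand only at natural numbers, so integrands need to
  agree only there.\<close>

lemma fermionic_integral_iter_cong:
  assumes "\<And>X. (\<And>i. X i \<in> \<nat>) \<Longrightarrow> f X = g X"
  shows "fermionic_integral_iter p r f = fermionic_integral_iter p r g"
  using assms
proof (induction r arbitrary: f g)
  case (Suc r)
  show ?case unfolding fermionic_integral_iter.simps
    by (intro fermionic_integral_cong Suc.IH Suc.prems) auto
qed simp

context padic_complex_field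
begin

lemma fermionic_integral_shift_op:
  assumes "odd p" "y \<in> Zp" "pnorm (1 - q) < 1" "pnorm (1 - c::'a) < 1"
  shows "fermionic_integral p (\<lambda>z. a * zpow c z * poly (shift_op q c G) (qnum q (y + z))) =
    2 * a * poly G (qnum q y)"
proof -
  \<comment> \<open>With g(m) = (-c)^m G[y+m], the summand is a (g(m) - g(m+1)).\<close>
  have telescope: "(\<Sum>m<M. a * zpow c (of_nat m) * poly (shift_op q c G) (qnum q (y + of_nat m)) * (- 1) ^ m) =
      a * (poly G (qnum q y) - (- 1) ^ M * (c ^ M * poly G (qnum q (y + of_nat M))))" for M
  proof (induction M)
    case (Suc M)
    have "qnum q (y + of_nat (Suc M)) = 1 + q * qnum q (y + of_nat M)"
      using qnum_plus_one[OF Zp_plus_of_nat[OF assms(2), of M] assms(3)] by (simp add: add_ac)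
    then show ?case using Suc
      by (simp add: shift_op_def poly_pcompose zpow_of_nat algebra_simps)
  qed simp
  \<comment> \<open>Since \<open>p ^ N\<close> is odd, the boundary term enters with a plus sign. It
    tends to the value of G at [y], whence the factor 2.\<close>
  have "(\<lambda>N. a * (poly G (qnum q y) + c ^ (p ^ N) * poly G (qnum q (y + of_nat (p ^ N)))))
      \<longlonglongrightarrow> a * (poly G (qnum q y) + 1 * poly G (qnum q y))"
    by (intro padic_tendsto_mult padic_tendsto_add tendsto_const one_unit_p_power_tendsto
        padic_tendsto_poly qnum_plus_p_power_tendsto assms)
  then have "(\<lambda>N. \<Sum>m<p ^ N. a * zpow c (of_nat m) * poly (shift_op q c G) (qnum q (y + of_nat m)) * (- 1) ^ m)
      \<longlonglongrightarrow> 2 * a * poly G (qnum q y)"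
    unfolding telescope using assms(1) by (simp add: algebra_simps)
  then show ?thesis unfolding fermionic_integral_def by (rule limI)
qed

text \<open>The factor a and the base point y are general so that the induction can absorb the outer
  variable z into both, as \<open>a * zpow ?c z\<close> and y + z.\<close>

lemma fermionic_integral_iter_shift_ops:
  assumes "odd p" "y \<in> Zp" "pnorm (1 - q) < 1" "\<And>i. pnorm (1 - c i::'a) < 1"
  shows "fermionic_integral_iter p r (\<lambda>X. a * (\<Prod>i=1..r. zpow (c i) (X i)) *
      poly (shift_ops q c r G) (qnum q (y + (\<Sum>i=1..r. X i)))) = 2 ^ r * a * poly G (qnum q y)"
  using assms(2)
proof (induction r arbitrary: a y G)
  case (Suc r)
  let ?c = "c (Suc r)"
  have "fermionic_integral_iter p (Suc r) (\<lambda>X. a * (\<Prod>i=1..Suc r. zpow (c i) (X i)) *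
      poly (shift_ops q c (Suc r) G) (qnum q (y + (\<Sum>i=1..Suc r. X i)))) =
    fermionic_integral p (\<lambda>z. fermionic_integral_iter p r (\<lambda>X.
      (a * zpow ?c z) * (\<Prod>i=1..r. zpow (c i) (X i)) *
      poly (shift_ops q c r (shift_op q ?c G)) (qnum q ((y + z) + (\<Sum>i=1..r. X i)))))"
    by (simp add: shift_ops_commute mult_ac add_ac)
  also have "\<dots> = fermionic_integral p (\<lambda>z. (2 ^ r * a) * zpow ?c z *
      poly (shift_op q ?c G) (qnum q (y + z)))"
    by (intro fermionic_integral_cong, subst Suc.IH)
      (simp_all add: Zp_plus_of_nat[OF Suc.prems] mult_ac)
  also have "\<dots> = 2 * (2 ^ r * a) * poly G (qnum q y)"
    using assms Suc.prems by (intro fermionic_integral_shift_op)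
  finally show ?case by simp
qed simp

text \<open>At natural arguments all powers have integer exponents, so ordinary exponent laws
  separate the variables.\<close>

lemma zpow_sum_eq_prod:
  fixes X :: "nat \<Rightarrow> 'a" and e :: "nat \<Rightarrow> int" and r :: nat
  assumes "pnorm (1 - q) < 1" "pnorm (1 - w::'a) < 1" "\<And>i. X i \<in> \<nat>"
  shows "zpow q (\<Sum>i=1..r. of_int (e i) * X i) * zpow w (\<Sum>i=1..r. X i) =
    (\<Prod>i=1..r. zpow (q powi e i * w) (X i))"
proof -
  have "\<exists>m. X i = of_nat m" for i using assms(3)[of i] by (auto simp: Nats_def)
  then obtain Y where Y: "\<And>i. X i = of_nat (Y i)" using choice[of "\<lambda>i m. X i = of_nat m"] by blast
  have q: "q \<noteq> 0" using assms(1) by (rule one_unit_nonzero)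
  have "(\<Sum>i=1..r. of_int (e i) * X i) = of_int (\<Sum>i=1..r. e i * int (Y i))" by (simp add: Y)
  moreover have "q powi (\<Sum>i=1..r. e i * int (Y i)) = (\<Prod>i=1..r. (q powi e i) ^ Y i)"
    using q by (induction r) (simp_all add: power_int_add power_int_mult)
  moreover have "zpow w (\<Sum>i=1..r. X i) = (\<Prod>i=1..r. w ^ Y i)"
    by (simp add: Y zpow_of_nat power_sum flip: of_nat_sum)
  ultimately show ?thesis
    by (simp only: zpow_of_int[OF assms(1)] prod.distrib[symmetric])
      (simp add: Y zpow_of_nat power_mult_distrib)
qed

end

section \<open>Evaluation of both sides through a common polynomial G\<close>

theorem theorem12:
  fixes p :: nat and q w x :: "'a::{field_char_0,complete_space}"
    and h :: int and r n :: nat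
  assumes "padic_complex_field TYPE('a) p" and "odd p"
    and "pnorm (1 - q) < 1" and "pnorm (1 - w) < 1"
    and "r \<ge> 1" and "x \<in> Zp"
  shows "genocchi h r w q (n + r) x / (fact r * of_nat ((n + r) choose r)) =
           fermionic_integral_iter p r (\<lambda>X.
             zpow q (\<Sum>i=1..r. of_int (h - int i + 1) * X i) *
             zpow w (\<Sum>i=1..r. X i) * qnum q (x + (\<Sum>i=1..r. X i)) ^ n)
       \<and> fermionic_integral_iter p r (\<lambda>X.
             zpow q (\<Sum>i=1..r. of_int (h - int i + 1) * X i) *
             zpow w (\<Sum>i=1..r. X i) * qnum q (x + (\<Sum>i=1..r. X i)) ^ n) =
           euler p h r w q n x
       \<and> (\<forall>k<r. genocchi h r w q k x = 0)"
proof (intro conjI allI impI)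
  interpret padic_complex_field p "TYPE('a)" by (rule assms(1))
  note q = assms(3) and w = assms(4)
  have q0: "q \<noteq> 0" using q by (rule one_unit_nonzero)
  define c where "c i = q powi (h - int i + 1) * w" for i :: nat
  define \<kappa> where "\<kappa> = q powi h * w"
  define Y where "Y m = qnum q (x + of_nat m)" for m
  have c_unit: "pnorm (1 - c i) < 1" for i
    unfolding c_def by (intro one_unit_mult one_unit_power_int q w)
  have nz_c: "1 + c i * q ^ m \<noteq> 0" for i m
    by (intro one_plus_one_unit_nonzero one_unit_mult one_unit_power c_unit q assms(2))
  \<comment> \<open>Passing from i to i + 1 turns the exponent h - i + 1 into h - i. The weights of
    the integrand thus match those of the Pascal rule in base 1/q.\<close>
  have c_Suc: "c (Suc i) = \<kappa> * inverse q ^ i" for i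
    using q0 by (simp add: c_def \<kappa>_def power_int_diff field_simps)
  have nz_\<kappa>: "1 + \<kappa> * inverse q ^ i * q ^ m \<noteq> 0" for i m
    using nz_c[of "Suc i" m] by (simp add: c_Suc)
  have Y_Suc: "Y (Suc m) = 1 + q * Y m" for m
    using qnum_plus_one[OF Zp_plus_of_nat[OF assms(6), of m] q] by (simp add: Y_def add_ac)
  obtain G where G: "shift_ops q c r G = monom 1 n"
    using shift_ops_surj[OF q0, of c] nz_c by blast
  have integral: "fermionic_integral_iter p r (\<lambda>X.
      zpow q (\<Sum>i=1..r. of_int (h - int i + 1) * X i) *
      zpow w (\<Sum>i=1..r. X i) * qnum q (x + (\<Sum>i=1..r. X i)) ^ n) = 2 ^ r * poly G (qnum q x)"
  proof -
    have "fermionic_integral_iter p r (\<lambda>X.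
        zpow q (\<Sum>i=1..r. of_int (h - int i + 1) * X i) *
        zpow w (\<Sum>i=1..r. X i) * qnum q (x + (\<Sum>i=1..r. X i)) ^ n) =
      fermionic_integral_iter p r (\<lambda>X. 1 * (\<Prod>i=1..r. zpow (c i) (X i)) *
        poly (shift_ops q c r G) (qnum q (x + (\<Sum>i=1..r. X i))))"
      unfolding G c_def
      by (intro fermionic_integral_iter_cong, subst zpow_sum_eq_prod[OF q w])
        (simp_all add: poly_monom)
    also have "\<dots> = 2 ^ r * 1 * poly G (qnum q x)"
      by (intro fermionic_integral_iter_shift_ops assms q c_unit)
    finally show ?thesis by simp
  qed
  have "reg_sums (qseries r q \<kappa> Y (monom 1 n)) (poly G (Y 0))"
    unfolding G[symmetric] using Y_Suc q0 nz_\<kappa> c_Suc by (rule qseries_reg_sums_shift_ops)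
  \<comment> \<open>The factor 1/n! comes from the coefficient of t^n in the exponential
    series.\<close>
  then have "reg_sums (\<lambda>m. inverse (fact n) * qseries r q \<kappa> Y (monom 1 n) m)
      (inverse (fact n) * poly G (qnum q x))"
    by (intro reg_sums_cmult) (simp add: Y_def)
  moreover have "inverse (fact n) * qseries r q \<kappa> Y (monom 1 n) m = fps_nth (fps_const
        (qbinom (m + r - 1) m (inverse q) * (-1) ^ m * power_int q (h * int m) * w ^ m) *
        fps_exp (qnum q (of_nat m + x))) n" for m
  proof -
    have "(- \<kappa>) ^ m = (- 1) ^ m * q powi (h * int m) * w ^ m"
      by (subst power_minus) (simp add: \<kappa>_def power_mult_distrib power_int_mult)
    then show ?thesis
      by (simp add: qseries_def Y_def poly_monom add.commute divide_inverse mult_ac)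
  qed
  \<comment> \<open>The factor t^r moves coefficient n of the regularized series to n + r.\<close>
  ultimately have "fps_nth (genocchi_gf h r w q x) (n + r) =
      2 ^ r * (inverse (fact n) * poly G (qnum q x))"
    by (simp add: genocchi_gf_def fps_reg_sum_def reg_sum_eq mult.assoc fps_X_power_mult_nth)
  moreover have "fact (n + r) = (fact n * (fact r * of_nat ((n + r) choose r)) :: 'a)"
    by (simp add: binomial_fact)
  moreover have "of_nat ((n + r) choose r) \<noteq> (0::'a)" by simp
  ultimately show "genocchi h r w q (n + r) x / (fact r * of_nat ((n + r) choose r)) =
      fermionic_integral_iter p r (\<lambda>X.
        zpow q (\<Sum>i=1..r. of_int (h - int i + 1) * X i) *
        zpow w (\<Sum>i=1..r. X i) * qnum q (x + (\<Sum>i=1..r. X i)) ^ n)"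
    unfolding integral genocchi_def by (simp add: field_simps)
next
  show "fermionic_integral_iter p r (\<lambda>X.
        zpow q (\<Sum>i=1..r. of_int (h - int i + 1) * X i) *
        zpow w (\<Sum>i=1..r. X i) * qnum q (x + (\<Sum>i=1..r. X i)) ^ n) = euler p h r w q n x"
    unfolding euler_def by (simp only: mult_ac)
next
  fix k assume "k < r"
  \<comment> \<open>The generating function is divisible by t^r.\<close>
  then show "genocchi h r w q k x = 0"
    by (simp add: genocchi_def genocchi_gf_def mult.assoc fps_X_power_mult_nth)
qed

end
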